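(* Let $N_t$ be the self-exciting point process with rate function $\lambda$ and initial condition $\gamma>0$. Assume that $\lim_{z\to\infty}\frac{\lambda(z)}{z^{\beta}}=\alpha$ for some $\alpha>0$ and $0<\beta<1$. Then, for any fixed $t>0$, $$\lim_{\ell\to\infty}\frac{1}{\ell\log\ell}\log\mathbb{P}(N_t\ge\ell)=-(1-\beta).$$
   Context: Model: $\lambda:\mathbb{R}_{\ge 0}\to\mathbb{R}_{\ge 0}$ and $\gamma> 0$ are given; $N_t$ is a simple point process on $(0,\infty)$ with $N_0=0$ (empty past history) whose intensity at time $t$ with respect to its natural filtration is $\lambda_t=\lambda\left(\frac{N_{t-}+\gamma}{t+1}\right)$. Standing assumptions: $\lambda$ is (strictly) increasing and continuously differentiable; the equation $x=\lambda(x)$ has finitely many solutions, and each solution $x^*$ satisfies either $\lambda'(x^* )<1$ or $\lambda'(x^* )>1$. *)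

theory Defs
  imports "HOL-Probability.Probability"
begin

text \<open>
  A simple point process on \<open>(0,\<infinity>)\<close> is given by its random set of points \<open>X \<omega>\<close>, which is finite on
  bounded intervals. The associated counting process \<open>N\<^sub>t = N(0,t]\<close> is \<^term>\<open>counting_process X t\<close>; it starts at
  0, is right-continuous and has unit jumps, and \<open>N\<^sub>t\<^sub>-\<close> is \<open>N(0,t)\<close>.
\<close>

definition counting_process :: "('a \<Rightarrow> real set) \<Rightarrow> real \<Rightarrow> 'a \<Rightarrow> nat" where
  "counting_process X t \<omega> = card (X \<omega> \<inter> {0<..t})"

definition counting_process_left :: "('a \<Rightarrow> real set) \<Rightarrow> real \<Rightarrow> 'a \<Rightarrow> nat" where
  "counting_process_left X t \<omega> = card (X \<omega> \<inter> {0<..<t})"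

definition simple_point_process :: "'a measure \<Rightarrow> ('a \<Rightarrow> real set) \<Rightarrow> bool" where
  "simple_point_process M X \<longleftrightarrow>
     (\<forall>\<omega>\<in>space M. X \<omega> \<subseteq> {0<..} \<and> (\<forall>t. finite (X \<omega> \<inter> {0<..t}))) \<and>
     (\<forall>t. counting_process X t \<in> measurable M (count_space UNIV))"

definition natural_filtration :: "'a measure \<Rightarrow> ('a \<Rightarrow> real set) \<Rightarrow> real \<Rightarrow> 'a measure" where
  "natural_filtration M X t =
     sigma (space M) {counting_process X s -` A \<inter> space M | s A. 0 \<le> s \<and> s \<le> t}"

definition progressively_measurable ::
  "(real \<Rightarrow> 'a measure) \<Rightarrow> (real \<Rightarrow> 'a \<Rightarrow> real) \<Rightarrow> bool" where
  "progressively_measurable F L \<longleftrightarrow>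
     (\<forall>t\<ge>0. (\<lambda>(s, \<omega>). L s \<omega>) \<in> borel_measurable (restrict_space borel {0..t} \<Otimes>\<^sub>M F t))"

definition predictable_sigma :: "'a measure \<Rightarrow> (real \<Rightarrow> 'a measure) \<Rightarrow> (real \<times> 'a) measure" where
  "predictable_sigma M F =
     sigma ({0<..} \<times> space M) {{a<..b} \<times> A | a b A. 0 \<le> a \<and> a \<le> b \<and> A \<in> sets (F a)}"

text \<open>
  \<open>L\<close> is an intensity of the point process with respect to the filtration \<open>F\<close> if
  \<open>E \<integral> C\<^sub>s dN\<^sub>s = E \<integral> C\<^sub>s L\<^sub>s ds\<close> for all nonnegative predictable \<open>C\<close> (Bremaud's definition). The integral
  with respect to \<open>dN\<close> is the sum over the points of the process. Testing against all predictable \<open>C\<close>,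
  and not only requiring \<open>E[N\<^sub>b - N\<^sub>a | F\<^sub>a] = E[\<integral>\<^sub>a\<^sup>b L\<^sub>s ds | F\<^sub>a]\<close>, gives a meaningful condition without
  assuming in advance that \<open>N\<^sub>t\<close> is integrable.
\<close>

definition has_intensity ::
  "'a measure \<Rightarrow> (real \<Rightarrow> 'a measure) \<Rightarrow> ('a \<Rightarrow> real set) \<Rightarrow> (real \<Rightarrow> 'a \<Rightarrow> real) \<Rightarrow> bool" where
  "has_intensity M F X L \<longleftrightarrow>
     (\<forall>s\<ge>0. \<forall>\<omega>\<in>space M. 0 \<le> L s \<omega>) \<and>
     progressively_measurable F L \<and>
     (\<forall>t\<ge>0. AE \<omega> in M. (\<integral>\<^sup>+s\<in>{0..t}. ennreal (L s \<omega>) \<partial>lborel) < \<infinity>) \<and>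
     (\<forall>C :: real \<Rightarrow> 'a \<Rightarrow> ennreal.
        (\<lambda>(s, \<omega>). C s \<omega>) \<in> borel_measurable (predictable_sigma M F) \<longrightarrow>
        (\<integral>\<^sup>+\<omega>. (\<integral>\<^sup>+s. C s \<omega> \<partial>count_space (X \<omega>)) \<partial>M) =
        (\<integral>\<^sup>+\<omega>. (\<integral>\<^sup>+s\<in>{0<..}. (C s \<omega> * ennreal (L s \<omega>)) \<partial>lborel) \<partial>M))"

definition self_exciting_process ::
  "'a measure \<Rightarrow> ('a \<Rightarrow> real set) \<Rightarrow> (real \<Rightarrow> real) \<Rightarrow> real \<Rightarrow> bool" where
  "self_exciting_process M X lam \<gamma> \<longleftrightarrow>
     prob_space M \<and> simple_point_process M X \<and>
     has_intensity M (natural_filtration M X) X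
       (\<lambda>t \<omega>. lam ((real (counting_process_left X t \<omega>) + \<gamma>) / (t + 1)))"

text \<open>
  The rate function is only relevant on \<open>[0,\<infinity>)\<close>; its derivative at 0 is one-sided.
\<close>

definition rate_function :: "(real \<Rightarrow> real) \<Rightarrow> bool" where
  "rate_function lam \<longleftrightarrow>
     (\<forall>x\<ge>0. 0 \<le> lam x) \<and>
     strict_mono_on {0..} lam \<and>
     finite {x. 0 \<le> x \<and> x = lam x} \<and>
     (\<exists>lam'. (\<forall>x\<ge>0. (lam has_real_derivative lam' x) (at x within {0..})) \<and>
        continuous_on {0..} lam' \<and>
        (\<forall>x\<ge>0. x = lam x \<longrightarrow> lam' x < 1 \<or> lam' x > 1))"

end

(*
  Testing the intensity against the predictable indicator of {N_{s-} = n, s <= t} gives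
    P(N_t >= n+1) = int_0^t r_n(s) P(N_{s-} = n) ds,   r_n(s) = lam((n + gamma) / (s + 1)),
  so the functions P(N_t >= n) are Lipschitz and solve the forward equations of a pure birth process.
  On [0,t] the rates lie between c (n+1)^beta and C (n+1)^beta. Dropping the loss term gives
  P(N_t >= n) <= (C t)^n (n!)^(beta-1), and bounding all loss rates by the one of level n gives
  P(N_t = n) >= exp(-C t (n+1)^beta) (c t)^n (n!)^(beta-1); the factor exp(-C t (n+1)^beta) is
  negligible on the scale n ln n because beta < 1.
*)

theory Submission
  imports Defs "HOL-Real_Asymp.Real_Asymp"
begin

section \<open>Ranks in a finite linearly ordered set\<close>

text \<open>The rank map is strictly increasing on \<open>S\<close>, hence injective, and takes
  values below \<open>card S\<close>. By cardinality it is a bijection onto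
  \<open>{..<card S}\<close>, so each admissible rank is attained exactly once.\<close>

lemma card_points_with_rank:
  fixes S :: "'b::linorder set"
  assumes "finite S"
  shows "card {s\<in>S. card (S \<inter> {..<s}) = n} = (if n < card S then 1 else 0)"
proof -
  let ?r = "\<lambda>s. card (S \<inter> {..<s})"
  have mono: "?r s < ?r u" if "s \<in> S" "s < u" for s u
    using that assms by (intro psubset_card_mono) auto
  have inj: "inj_on ?r S"
  proof (rule inj_onI)
    fix s u assume "s \<in> S" "u \<in> S" "?r s = ?r u"
    then show "s = u" using mono[of s u] mono[of u s] by (cases s u rule: linorder_cases) auto
  qed
  have "?r ` S \<subseteq> {..<card S}"
    using assms by (auto intro!: psubset_card_mono)
  moreover have "card (?r ` S) = card {..<card S}"
    using inj by (simp add: card_image)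
  ultimately have img: "?r ` S = {..<card S}"
    by (intro card_subset_eq) auto
  show ?thesis
  proof (cases "n < card S")
    case True
    then have "n \<in> ?r ` S" unfolding img by simp
    then obtain u where u: "u \<in> S" "?r u = n" by blast
    have "{s\<in>S. ?r s = n} = {u}"
      using u inj by (auto dest: inj_onD)
    then show ?thesis using True by simp
  next
    case False
    then have "n \<notin> ?r ` S" unfolding img by simp
    then have "{s\<in>S. ?r s = n} = {}" by blast
    then show ?thesis using False by (simp only: card.empty if_False)
  qed
qed

section \<open>The process, its tail probabilities and its left limits\<close>

locale self_exciting = prob_space M for M :: "'a measure" +
  fixes X :: "'a \<Rightarrow> real set" and lam :: "real \<Rightarrow> real" and \<gamma> :: real
  assumes rate: "rate_function lam" and gamma_pos: "\<gamma> > 0"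
    and self_exc: "self_exciting_process M X lam \<gamma>"
begin

definition tail :: "nat \<Rightarrow> real \<Rightarrow> real" where
  "tail n t = prob {\<omega>\<in>space M. n \<le> counting_process X t \<omega>}"

text \<open>The intensity depends on the left limit of the count, so the integral equation first
  appears in terms of this function. \<open>left_tail_eq_tail\<close> later identifies it with
  \<open>tail\<close> at positive times.\<close>

definition left_tail :: "nat \<Rightarrow> real \<Rightarrow> real" where
  "left_tail n t = prob {\<omega>\<in>space M. n \<le> counting_process_left X t \<omega>}"

text \<open>The birth rate at time s of a pure birth process in state n.\<close>

definition level_rate :: "nat \<Rightarrow> real \<Rightarrow> real" where
  "level_rate n s = lam ((real n + \<gamma>) / (s + 1))"

lemma points: "\<omega> \<in> space M \<Longrightarrow> X \<omega> \<subseteq> {0<..}" "\<omega> \<in> space M \<Longrightarrow> finite (X \<omega> \<inter> {0<..t})"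
  and measurable_count [measurable]: "counting_process X t \<in> measurable M (count_space UNIV)"
  using self_exc by (auto simp: self_exciting_process_def simple_point_process_def)

lemma finite_points_left: "\<omega> \<in> space M \<Longrightarrow> finite (X \<omega> \<inter> {0<..<t})"
  by (rule finite_subset[OF _ points(2)[of \<omega> t]]) auto

lemma count_le_left: "\<omega> \<in> space M \<Longrightarrow> q < s \<Longrightarrow> counting_process X q \<omega> \<le> counting_process_left X s \<omega>"
  unfolding counting_process_def counting_process_left_def
  by (intro card_mono finite_points_left) auto

lemma left_le_count: "\<omega> \<in> space M \<Longrightarrow> counting_process_left X s \<omega> \<le> counting_process X s \<omega>"
  unfolding counting_process_def counting_process_left_def
  by (intro card_mono points) auto

lemma left_mono: "\<omega> \<in> space M \<Longrightarrow> q \<le> s \<Longrightarrow> counting_process_left X q \<omega> \<le> counting_process_left X s \<omega>"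
  unfolding counting_process_left_def by (intro card_mono finite_points_left) auto

text \<open>Only finitely many points lie before s, so a rational time fits between the last of them
  and s. This turns a condition on the left limit into a countable union of conditions on the
  counting process itself.\<close>

lemma le_left_iff:
  assumes "\<omega> \<in> space M" "0 < s"
  shows "m \<le> counting_process_left X s \<omega> \<longleftrightarrow>
    (\<exists>q\<in>\<rat> \<inter> {0..}. q < s \<and> m \<le> counting_process X q \<omega>)"
proof
  assume m: "m \<le> counting_process_left X s \<omega>"
  let ?S = "X \<omega> \<inter> {0<..<s}"
  \<comment> \<open>Inserting 0 makes the maximum meaningful when there is no point before s, and
    forces the rational found below to be positive.\<close>
  have fin: "finite (insert 0 ?S)" using finite_points_left assms by simp
  have "Max (insert 0 ?S) < s" using fin assms by (subst Max_less_iff) auto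
  then obtain q where q: "q \<in> \<rat>" "Max (insert 0 ?S) < q" "q < s"
    using Rats_dense_in_real by blast
  have ub: "x < q" if "x \<in> insert 0 ?S" for x
    using Max_ge[OF fin that] q by linarith
  have "?S \<subseteq> X \<omega> \<inter> {0<..q}" using ub by force
  then have "counting_process_left X s \<omega> \<le> counting_process X q \<omega>"
    unfolding counting_process_def counting_process_left_def
    by (intro card_mono points assms)
  moreover have "0 \<le> q" using ub[of 0] by simp
  ultimately show "\<exists>q\<in>\<rat> \<inter> {0..}. q < s \<and> m \<le> counting_process X q \<omega>"
    using q m by force
next
  assume "\<exists>q\<in>\<rat> \<inter> {0..}. q < s \<and> m \<le> counting_process X q \<omega>"
  then show "m \<le> counting_process_left X s \<omega>"
    using count_le_left[OF assms(1)] le_trans by blast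
qed

section \<open>Predictability and measurability of the level sets\<close>

definition left_above :: "nat \<Rightarrow> (real \<times> 'a) set" where
  "left_above m = {(s, \<omega>). 0 < s \<and> \<omega> \<in> space M \<and> m \<le> counting_process_left X s \<omega>}"

text \<open>The right-hand side is a countable union of rectangles whose event is decided at the
  left endpoint of the time interval. The union over k is there because generators of the
  predictable sigma-algebra have bounded time intervals.\<close>

lemma left_above_eq:
  "left_above m = (\<Union>q\<in>\<rat> \<inter> {0..}. \<Union>k::nat. {q<..q + real k} \<times> {\<omega>\<in>space M. m \<le> counting_process X q \<omega>})"
    (is "_ = ?R")
proof (intro set_eqI iffI)
  fix z assume "z \<in> left_above m"
  then obtain s \<omega> where z: "z = (s, \<omega>)" "0 < s" "\<omega> \<in> space M" "m \<le> counting_process_left X s \<omega>"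
    by (auto simp: left_above_def)
  then obtain q where q: "q \<in> \<rat> \<inter> {0..}" "q < s" "m \<le> counting_process X q \<omega>"
    using le_left_iff by blast
  obtain k :: nat where "s - q \<le> real k" using real_arch_simple by blast
  then have "z \<in> {q<..q + real k} \<times> {\<omega>\<in>space M. m \<le> counting_process X q \<omega>}"
    using q z by auto
  then show "z \<in> ?R" using q(1) by blast
next
  fix z assume "z \<in> ?R"
  then obtain q k s \<omega> where "q \<in> \<rat> \<inter> {0..}" "z = (s, \<omega>)" "q < s" "\<omega> \<in> space M"
    "m \<le> counting_process X q \<omega>" by auto
  then show "z \<in> left_above m"
    using le_left_iff[of \<omega> s m] by (auto simp: left_above_def)
qed

lemma countable_nonneg_rats: "countable (\<rat> \<inter> {0::real..})"
  by (rule countable_Int1) (rule countable_rat)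

lemma left_above_measurable: "left_above m \<in> sets (borel \<Otimes>\<^sub>M M)"
  unfolding left_above_eq
  by (intro sets.countable_UN' countable_nonneg_rats sets.countable_UN image_subsetI)
    (auto intro!: pair_measureI)

text \<open>The event concerns the count at the left endpoint a, so it lies in the natural
  filtration at a and the rectangle is a generator.\<close>

lemma rectangle_predictable:
  assumes "0 \<le> a" "a \<le> b"
  shows "{a<..b} \<times> {\<omega>\<in>space M. P (counting_process X a \<omega>)} \<in> 
    sets (predictable_sigma M (natural_filtration M X))"
proof -
  let ?F = "natural_filtration M X"
  let ?G = "{{a<..b} \<times> A | a b A. 0 \<le> a \<and> a \<le> b \<and> A \<in> sets (?F a)}"
  have sub: "A \<subseteq> space M" if "A \<in> sets (?F u)" for A u
  proof -
    have "space (?F u) = space M"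
      by (auto simp: natural_filtration_def space_measure_of_conv)
    then show ?thesis using sets.sets_into_space[OF that] by simp
  qed
  have G: "?G \<subseteq> Pow ({0<..} \<times> space M)" using sub by fastforce
  have "{\<omega>\<in>space M. P (counting_process X a \<omega>)} = counting_process X a -` Collect P \<inter> space M" by auto
  then have "{\<omega>\<in>space M. P (counting_process X a \<omega>)} \<in> sets (?F a)"
    using assms unfolding natural_filtration_def
    by (subst sets_measure_of) (blast intro: sigma_sets.Basic)+
  then have "{a<..b} \<times> {\<omega>\<in>space M. P (counting_process X a \<omega>)} \<in> ?G"
    using assms by blast
  then show ?thesis
    unfolding predictable_sigma_def using G by (subst sets_measure_of) (auto intro!: sigma_sets.Basic)
qed

lemma left_above_predictable: "left_above m \<in> sets (predictable_sigma M (natural_filtration M X))"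
  unfolding left_above_eq
  by (intro sets.countable_UN' countable_nonneg_rats sets.countable_UN image_subsetI)
    (auto intro!: rectangle_predictable)

text \<open>Its indicator is the predictable process against which the intensity is tested.\<close>

definition at_level :: "nat \<Rightarrow> real \<Rightarrow> (real \<times> 'a) set" where
  "at_level n t = {(s, \<omega>). 0 < s \<and> s \<le> t \<and> \<omega> \<in> space M \<and> counting_process_left X s \<omega> = n}"

lemma at_level_eq: "at_level n t = (left_above n - left_above (Suc n)) \<inter> ({0<..t} \<times> space M)"
  by (auto simp: at_level_def left_above_def)

lemma at_level_measurable [measurable]: "at_level n t \<in> sets (borel \<Otimes>\<^sub>M M)"
  unfolding at_level_eq by (intro sets.Int sets.Diff left_above_measurable pair_measureI) auto

lemma at_level_predictable:
  assumes "0 \<le> t"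
  shows "at_level n t \<in> sets (predictable_sigma M (natural_filtration M X))"
  unfolding at_level_eq
  using rectangle_predictable[of 0 t "\<lambda>_. True"] assms
  by (intro sets.Int sets.Diff left_above_predictable) auto

text \<open>A point s has exactly n predecessors only if it is the point number n + 1. The sum over
  the points therefore records whether that point has occurred by time t.\<close>

lemma nn_integral_at_level_points:
  assumes "\<omega> \<in> space M"
  shows "(\<integral>\<^sup>+s. indicator (at_level n t) (s, \<omega>) \<partial>count_space (X \<omega>)) =
    indicator {\<omega>\<in>space M. Suc n \<le> counting_process X t \<omega>} \<omega>"
proof -
  let ?S = "X \<omega> \<inter> {0<..t}"
  have *: "X \<omega> \<inter> {0<..<s} = ?S \<inter> {..<s}" if "s \<le> t" for s using that by auto
  have **: "{s \<in> X \<omega>. (s, \<omega>) \<in> at_level n t} = {s\<in>?S. card (?S \<inter> {..<s}) = n}"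
    using assms points(1)[OF assms] * by (auto simp: at_level_def counting_process_left_def)
  have "(\<integral>\<^sup>+s. indicator (at_level n t) (s, \<omega>) \<partial>count_space (X \<omega>)) =
      (\<integral>\<^sup>+s. indicator {s \<in> X \<omega>. (s, \<omega>) \<in> at_level n t} s \<partial>count_space (X \<omega>))"
    by (intro nn_integral_cong) (auto simp: indicator_def)
  also have "\<dots> = emeasure (count_space (X \<omega>)) {s \<in> X \<omega>. (s, \<omega>) \<in> at_level n t}"
    by (rule nn_integral_indicator) auto
  also have "\<dots> = of_nat (card {s\<in>?S. card (?S \<inter> {..<s}) = n})"
    unfolding ** by (rule emeasure_count_space_finite)
      (auto intro: finite_subset[OF _ points(2)[OF assms, of t]])
  also have "\<dots> = indicator {\<omega>\<in>space M. Suc n \<le> counting_process X t \<omega>} \<omega>"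
    using assms points(2)[OF assms, of t]
    by (subst card_points_with_rank) (auto simp: counting_process_def indicator_def)
  finally show ?thesis .
qed

text \<open>For s > 0 the event is a section of the product-measurable set
  \<open>left_above n\<close>; for other s the left count is 0.\<close>

lemma left_tail_measurable_event [measurable]:
  "{\<omega>\<in>space M. n \<le> counting_process_left X s \<omega>} \<in> sets M"
proof (cases "0 < s")
  case True
  have "{\<omega>\<in>space M. n \<le> counting_process_left X s \<omega>} = Pair s -` left_above n"
    using True by (auto simp: left_above_def)
  then show ?thesis using sets_Pair1[OF left_above_measurable] by simp
next
  case False
  then have "counting_process_left X s \<omega> = 0" for \<omega> by (simp add: counting_process_left_def)
  then show ?thesis by (cases "n = 0") auto
qed

lemma prob_level_eq:
  "prob {\<omega>\<in>space M. counting_process_left X s \<omega> = n} = left_tail n s - left_tail (Suc n) s"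
proof -
  let ?A = "\<lambda>n. {\<omega>\<in>space M. n \<le> counting_process_left X s \<omega>}"
  have "{\<omega>\<in>space M. counting_process_left X s \<omega> = n} = ?A n - ?A (Suc n)"
    by auto
  moreover have "?A (Suc n) \<subseteq> ?A n" by auto
  then have "prob (?A n - ?A (Suc n)) = prob (?A n) - prob (?A (Suc n))"
    by (intro finite_measure_Diff left_tail_measurable_event)
  ultimately show ?thesis unfolding left_tail_def by simp
qed

section \<open>The rate function and the level rates\<close>

lemma lam_continuous: "continuous_on {0..} lam"
proof -
  obtain lam' where "\<forall>x\<ge>0. (lam has_real_derivative lam' x) (at x within {0..})"
    using rate unfolding rate_function_def by blast
  then show ?thesis
    by (intro DERIV_continuous_on) auto
qed

lemma lam_strict_mono: "strict_mono_on {0..} lam"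
  using rate unfolding rate_function_def by blast

lemma lam_mono: "0 \<le> x \<Longrightarrow> x \<le> y \<Longrightarrow> lam x \<le> lam y"
  by (rule strict_mono_on_leD[OF lam_strict_mono]) auto

lemma lam_nonneg: "0 \<le> x \<Longrightarrow> 0 \<le> lam x"
  using rate unfolding rate_function_def by blast

lemma lam_pos: "0 < x \<Longrightarrow> 0 < lam x"
  by (rule le_less_trans[OF lam_nonneg[OF order.refl] strict_mono_onD[OF lam_strict_mono]]) auto

lemma level_rate_nonneg: "0 \<le> s \<Longrightarrow> 0 \<le> level_rate n s"
  using gamma_pos unfolding level_rate_def by (intro lam_nonneg) auto

text \<open>At a fixed level the argument of \<open>lam\<close> decreases in time, so the rate is
  largest at time 0 and, on [0,t], smallest at t.\<close>

lemma level_rate_le: "0 \<le> s \<Longrightarrow> level_rate n s \<le> lam (real n + \<gamma>)"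
  using gamma_pos unfolding level_rate_def by (intro lam_mono) (auto simp: field_simps)

lemma level_rate_ge: "0 \<le> s \<Longrightarrow> s \<le> t \<Longrightarrow> lam ((real n + \<gamma>) / (t + 1)) \<le> level_rate n s"
  using gamma_pos unfolding level_rate_def by (intro lam_mono frac_le) auto

lemma continuous_level_rate: "continuous_on {0..} (level_rate n)"
  unfolding level_rate_def
  by (rule continuous_on_compose2[OF lam_continuous]) (use gamma_pos in \<open>auto intro!: continuous_intros\<close>)

section \<open>Integral and differential forward equations\<close>

text \<open>This is the intensity identity for the indicator of \<open>at_level n t\<close>. The sum
  over points has expectation \<open>tail (Suc n) t\<close>; on the other side the intensity equals
  the deterministic \<open>level_rate n s\<close> on the level set, and exchanging the integrals
  leaves the probability of being at level n just before s.\<close>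

lemma tail_Suc_nn_integral:
  assumes "0 \<le> t"
  shows "ennreal (tail (Suc n) t) =
    (\<integral>\<^sup>+s. ennreal (indicator {0<..t} s * (level_rate n s * (left_tail n s - left_tail (Suc n) s))) \<partial>lborel)"
proof -
  let ?L = "\<lambda>t \<omega>. lam ((real (counting_process_left X t \<omega>) + \<gamma>) / (t + 1))"
  let ?C = "\<lambda>s \<omega>. indicator (at_level n t) (s, \<omega>) :: ennreal"
  have "(\<lambda>(s, \<omega>). ?C s \<omega>) \<in> borel_measurable (predictable_sigma M (natural_filtration M X))"
    using at_level_predictable[OF assms] by (simp add: case_prod_beta')
  then have int: "(\<integral>\<^sup>+\<omega>. (\<integral>\<^sup>+s. ?C s \<omega> \<partial>count_space (X \<omega>)) \<partial>M) =
        (\<integral>\<^sup>+\<omega>. (\<integral>\<^sup>+s\<in>{0<..}. (?C s \<omega> * ennreal (?L s \<omega>)) \<partial>lborel) \<partial>M)"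
    using self_exc unfolding self_exciting_process_def has_intensity_def by blast
  have "ennreal (tail (Suc n) t) = (\<integral>\<^sup>+\<omega>. indicator {\<omega>\<in>space M. Suc n \<le> counting_process X t \<omega>} \<omega> \<partial>M)"
    by (simp add: tail_def emeasure_eq_measure)
  also have "\<dots> = (\<integral>\<^sup>+\<omega>. (\<integral>\<^sup>+s. ?C s \<omega> \<partial>count_space (X \<omega>)) \<partial>M)"
    by (intro nn_integral_cong) (simp add: nn_integral_at_level_points)
  also note int
  \<comment> \<open>The function \<open>lam\<close> is controlled on [0,\<infinity>) only, so an
    indicator is inserted to make the rate Borel on the whole line. The value is unchanged because
    \<open>at_level\<close> contains positive times only.\<close>
  also have "(\<integral>\<^sup>+\<omega>. (\<integral>\<^sup>+s\<in>{0<..}. (?C s \<omega> * ennreal (?L s \<omega>)) \<partial>lborel) \<partial>M) =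
     (\<integral>\<^sup>+\<omega>. (\<integral>\<^sup>+s. ?C s \<omega> * ennreal (indicator {0..} s * level_rate n s) \<partial>lborel) \<partial>M)"
    by (intro nn_integral_cong) (auto simp: at_level_def level_rate_def indicator_def)
  also have "\<dots> = (\<integral>\<^sup>+s. (\<integral>\<^sup>+\<omega>. ?C s \<omega> * ennreal (indicator {0..} s * level_rate n s) \<partial>M) \<partial>lborel)"
  proof -
    interpret P: pair_sigma_finite lborel M ..
    have [measurable]: "(\<lambda>s. indicator {0..} s * level_rate n s) \<in> borel_measurable borel"
      using borel_measurable_continuous_on_indicator[OF _ continuous_level_rate, of n] by simp
    show ?thesis
      by (rule P.Fubini') measurable
  qed
  also have "\<dots> = (\<integral>\<^sup>+s. ennreal (indicator {0<..t} s * (level_rate n s * (left_tail n s - left_tail (Suc n) s))) \<partial>lborel)"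
  proof (intro nn_integral_cong)
    fix s :: real
    let ?A = "{\<omega>\<in>space M. counting_process_left X s \<omega> = n}"
    show "(\<integral>\<^sup>+\<omega>. ?C s \<omega> * ennreal (indicator {0..} s * level_rate n s) \<partial>M) =
      ennreal (indicator {0<..t} s * (level_rate n s * (left_tail n s - left_tail (Suc n) s)))"
    proof (cases "s \<in> {0<..t}")
      case True
      have A: "?A \<in> sets M"
      proof -
        have "?A = {\<omega>\<in>space M. n \<le> counting_process_left X s \<omega>} - {\<omega>\<in>space M. Suc n \<le> counting_process_left X s \<omega>}"
          by auto
        then show ?thesis by simp
      qed
      have "(\<integral>\<^sup>+\<omega>. ?C s \<omega> * ennreal (indicator {0..} s * level_rate n s) \<partial>M) =
        (\<integral>\<^sup>+\<omega>. ennreal (level_rate n s) * indicator ?A \<omega> \<partial>M)"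
        using True by (intro nn_integral_cong) (auto simp: at_level_def indicator_def)
      also have "\<dots> = ennreal (level_rate n s) * emeasure M ?A"
        using A by (rule nn_integral_cmult_indicator)
      also have "\<dots> = ennreal (level_rate n s * (left_tail n s - left_tail (Suc n) s))"
        using True level_rate_nonneg[of s n] by (simp add: emeasure_eq_measure prob_level_eq[symmetric] ennreal_mult')
      finally show ?thesis using True by simp
    next
      case False
      then have "?C s \<omega> = 0" for \<omega> by (auto simp: at_level_def indicator_def)
      then show ?thesis using False by simp
    qed
  qed
  finally show ?thesis .
qed

lemma tail_nonneg_le_1: "0 \<le> tail n t" "tail n t \<le> 1"
  by (auto simp: tail_def)

lemma tail_mono:
  assumes "s \<le> t"
  shows "tail n s \<le> tail n t"
proof -
  have "counting_process X s \<omega> \<le> counting_process X t \<omega>" if "\<omega> \<in> space M" for \<omega>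
    using assms that unfolding counting_process_def by (intro card_mono points) auto
  then show ?thesis
    unfolding tail_def by (intro finite_measure_mono) (auto intro: order_trans)
qed

lemma left_tail_mono: "s \<le> t \<Longrightarrow> left_tail n s \<le> left_tail n t"
  unfolding left_tail_def
  by (intro finite_measure_mono) (auto intro: order_trans left_mono)

lemma left_tail_le_tail: "left_tail n s \<le> tail n s"
  unfolding left_tail_def tail_def
  by (intro finite_measure_mono) (auto intro: order_trans left_le_count)

lemma tail_le_left_tail: "q < s \<Longrightarrow> tail n q \<le> left_tail n s"
  unfolding left_tail_def tail_def
  by (intro finite_measure_mono left_tail_measurable_event) (auto intro: order_trans count_le_left)

lemma tail_decreasing: "tail (Suc n) t \<le> tail n t"
  unfolding tail_def by (intro finite_measure_mono) auto

lemma tail_0 [simp]: "tail 0 t = 1"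
  by (simp add: tail_def prob_space)

lemma tail_Suc_at_0 [simp]: "tail (Suc n) 0 = 0"
  by (simp add: tail_def counting_process_def)

text \<open>The integrand is a rate times a probability, hence at most
  \<open>lam (real n + \<gamma>)\<close>. Together with \<open>tail_mono\<close> this makes the
  tails Lipschitz.\<close>

lemma tail_increment_le:
  assumes "0 \<le> s" "s \<le> t"
  shows "tail (Suc n) t \<le> tail (Suc n) s + lam (real n + \<gamma>) * (t - s)"
proof -
  let ?h = "\<lambda>u. level_rate n u * (left_tail n u - left_tail (Suc n) u)"
  let ?B = "lam (real n + \<gamma>)"
  have B: "0 \<le> ?B" using gamma_pos by (intro lam_nonneg) auto
  \<comment> \<open>Borel measurability in time comes from monotonicity.\<close>
  have [measurable]: "left_tail m \<in> borel_measurable borel" for m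
    by (intro borel_measurable_mono monoI left_tail_mono)
  have [measurable]: "(\<lambda>u. indicator {0..} u * level_rate n u) \<in> borel_measurable borel"
    using borel_measurable_continuous_on_indicator[OF _ continuous_level_rate, of n] by simp
  have "(\<lambda>u. indicator {0<..s} u * ((indicator {0..} u * level_rate n u) * (left_tail n u - left_tail (Suc n) u)))
      \<in> borel_measurable borel" by measurable
  also have "(\<lambda>u. indicator {0<..s} u * ((indicator {0..} u * level_rate n u) * (left_tail n u - left_tail (Suc n) u)))
      = (\<lambda>u. indicator {0<..s} u * ?h u)"
    by (auto simp: indicator_def)
  finally have [measurable]: "(\<lambda>u. indicator {0<..s} u * ?h u) \<in> borel_measurable borel" .
  have h_le: "?h u \<le> ?B" if "0 \<le> u" for u
  proof -
    have "left_tail n u - left_tail (Suc n) u \<le> 1"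
      by (simp add: prob_level_eq[symmetric])
    moreover have "0 \<le> left_tail n u - left_tail (Suc n) u"
      by (simp add: prob_level_eq[symmetric])
    ultimately have "?h u \<le> ?B * 1"
      using level_rate_le level_rate_nonneg that B by (intro mult_mono) auto
    then show ?thesis by simp
  qed
  have "ennreal (tail (Suc n) t) = (\<integral>\<^sup>+u. ennreal (indicator {0<..t} u * ?h u) \<partial>lborel)"
    using assms by (intro tail_Suc_nn_integral) auto
  also have "\<dots> \<le> (\<integral>\<^sup>+u. ennreal (indicator {0<..s} u * ?h u) + ennreal ?B * indicator {s<..t} u \<partial>lborel)"
    using assms h_le by (intro nn_integral_mono) (auto simp: indicator_def intro!: ennreal_leI)
  also have "\<dots> = (\<integral>\<^sup>+u. ennreal (indicator {0<..s} u * ?h u) \<partial>lborel) + (\<integral>\<^sup>+u. ennreal ?B * indicator {s<..t} u \<partial>lborel)"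
    by (rule nn_integral_add) measurable
  also have "\<dots> = ennreal (tail (Suc n) s) + ennreal ?B * ennreal (t - s)"
    using assms by (simp add: tail_Suc_nn_integral nn_integral_cmult_indicator)
  also have "\<dots> = ennreal (tail (Suc n) s + ?B * (t - s))"
    using assms B tail_nonneg_le_1 by (simp add: ennreal_plus ennreal_mult)
  finally show ?thesis
    using assms B tail_nonneg_le_1 by (subst (asm) ennreal_le_iff) auto
qed

lemma continuous_tail: "continuous_on {0..} (tail n)"
proof (cases n)
  case 0
  then show ?thesis by simp
next
  case (Suc m)
  have B: "0 \<le> lam (real m + \<gamma>)" using gamma_pos by (intro lam_nonneg) auto
  have "(lam (real m + \<gamma>))-lipschitz_on {0..} (tail n)"
  proof (rule lipschitz_onI[OF _ B])
    fix x y :: real assume xy: "x \<in> {0..}" "y \<in> {0..}"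
    show "dist (tail n x) (tail n y) \<le> lam (real m + \<gamma>) * dist x y"
      using tail_increment_le[of x y m] tail_increment_le[of y x m] xy
        tail_mono[of x y n] tail_mono[of y x n]
      by (cases "x \<le> y") (auto simp: dist_real_def Suc)
  qed
  then show ?thesis by (rule lipschitz_on_continuous_on)
qed

text \<open>For q < s the value \<open>tail n q\<close> is at most \<open>left_tail n s\<close>; let
  q increase to s and use continuity of \<open>tail n\<close>.\<close>

lemma left_tail_eq_tail:
  assumes "0 < s"
  shows "left_tail n s = tail n s"
proof (rule antisym[OF left_tail_le_tail])
  have "((\<lambda>q. tail n q) \<longlongrightarrow> tail n s) (at_left s)"
  proof -
    have "isCont (tail n) s"
      by (rule continuous_on_interior[OF continuous_tail]) (use assms in simp)
    then show ?thesis using isCont_def filterlim_at_split by blast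
  qed
  then show "tail n s \<le> left_tail n s"
    by (rule tendsto_upperbound) (auto simp: eventually_at_left_field tail_le_left_tail intro: exI[of _ "s - 1"])
qed

text \<open>Once \<open>left_tail\<close> is replaced by \<open>tail\<close>, the integrand of the
  integral equation is continuous and the fundamental theorem of calculus applies.\<close>

lemma has_derivative_tail:
  assumes "0 < t"
  shows "DERIV (tail (Suc n)) t :> level_rate n t * (tail n t - tail (Suc n) t)"
proof -
  let ?k = "\<lambda>s. level_rate n s * (tail n s - tail (Suc n) s)"
  have cont: "continuous_on {0..x} ?k" for x
    by (intro continuous_intros continuous_on_subset[OF continuous_tail]
        continuous_on_subset[OF continuous_level_rate]) auto
  have eq: "tail (Suc n) x = integral {0..x} ?k" if "0 \<le> x" for x
  proof -
    have nonneg: "0 \<le> ?k s" if "s \<in> {0..x}" for s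
      using that level_rate_nonneg tail_decreasing[of n s] by auto
    have int: "(?k has_integral integral {0..x} ?k) {0..x}"
      using integrable_continuous_real[OF cont] by (rule integrable_integral)
    have "ennreal (tail (Suc n) x) = (\<integral>\<^sup>+s. ennreal (indicator {0<..x} s * ?k s) \<partial>lborel)"
      unfolding tail_Suc_nn_integral[OF that]
      by (intro nn_integral_cong) (auto simp: indicator_def left_tail_eq_tail)
    also have "\<dots> = (\<integral>\<^sup>+s. ennreal (indicator {0..x} s * ?k s) \<partial>lborel)"
      by (intro nn_integral_cong_AE eventually_mono[OF AE_lborel_singleton[of 0]])
        (simp add: indicator_def less_le)
    also have "\<dots> = ennreal (integral {0..x} ?k)"
      by (rule nn_integral_has_integral_lebesgue[OF nonneg int])
    finally show ?thesis
      using tail_nonneg_le_1 integral_nonneg[OF integrable_continuous_real[OF cont] nonneg]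
      by (simp add: ennreal_inj)
  qed
  \<comment> \<open>The interval reaches past t so that t is interior and the derivative becomes
    two-sided.\<close>
  have "((\<lambda>x. integral {0..x} ?k) has_real_derivative ?k t) (at t within {0..t+1})"
    by (rule integral_has_real_derivative[OF cont]) (use assms in auto)
  then have "((\<lambda>x. integral {0..x} ?k) has_real_derivative ?k t) (at t)"
    using assms by (simp add: at_within_Icc_at)
  then show ?thesis
    by (rule has_field_derivative_transform_within[OF _ assms]) (auto simp: eq dist_real_def)
qed

section \<open>Bounds on tail and level probabilities\<close>

text \<open>Induction on n: discarding the loss term and using the largest rate, the derivative of
  \<open>tail (Suc n)\<close> is at most \<open>lam (real n + \<gamma>)\<close> times the bound for
  \<open>tail n\<close>, which is the derivative of the next bound.\<close>

lemma tail_le: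
  assumes "0 \<le> t"
  shows "tail n t \<le> (\<Prod>k<n. lam (real k + \<gamma>)) * t ^ n / fact n"
  using assms
proof (induction n arbitrary: t)
  case 0
  then show ?case by simp
next
  case (Suc n)
  let ?P = "\<lambda>n. \<Prod>k<n. lam (real k + \<gamma>)"
  \<comment> \<open>Both terms vanish at 0, so it suffices that this difference is
    nondecreasing.\<close>
  let ?f = "\<lambda>s. ?P (Suc n) * s ^ Suc n / fact (Suc n) - tail (Suc n) s"
  have "?f 0 \<le> ?f t"
  proof (rule DERIV_nonneg_imp_increasing_open[OF Suc.prems])
    fix s assume s: "0 < s" "s < t"
    let ?D = "?P (Suc n) * s ^ n / fact n - level_rate n s * (tail n s - tail (Suc n) s)"
    have "DERIV ?f s :> ?P (Suc n) * (real (Suc n) * s ^ n) / fact (Suc n)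
        - level_rate n s * (tail n s - tail (Suc n) s)"
      by (rule derivative_eq_intros has_derivative_tail s refl | simp)+
    moreover have "?P (Suc n) * (real (Suc n) * s ^ n) / fact (Suc n) = ?P (Suc n) * s ^ n / fact n"
      by (simp del: prod.lessThan_Suc of_nat_Suc)
    ultimately have "DERIV ?f s :> ?D" by (simp only:)
    moreover have "level_rate n s * (tail n s - tail (Suc n) s) \<le> lam (real n + \<gamma>) * (?P n * s ^ n / fact n)"
    proof (intro mult_mono level_rate_le)
      show "tail n s - tail (Suc n) s \<le> ?P n * s ^ n / fact n"
        using Suc.IH[of s] s tail_nonneg_le_1(1)[of "Suc n" s] by linarith
    qed (use s gamma_pos tail_decreasing[of n s] in \<open>auto intro: lam_nonneg\<close>)
    then have "?D \<ge> 0" by (simp add: mult_ac)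
    ultimately show "\<exists>y. DERIV ?f s :> y \<and> 0 \<le> y" by blast
  next
    show "continuous_on {0..t} ?f"
      by (intro continuous_intros continuous_on_subset[OF continuous_tail]) auto
  qed
  then show ?case by simp
qed

text \<open>Multiplying by the integrating factor \<open>exp (B s)\<close>, where \<open>B\<close> dominates all the rates up to level
  \<open>n\<close>, leaves only the gain term of the forward equation.\<close>

lemma level_prob_ge:
  assumes "k \<le> n" "0 \<le> s" "s \<le> t"
  shows "(\<Prod>i<k. lam ((real i + \<gamma>) / (t + 1))) * s ^ k / fact k
    \<le> exp (lam (real n + \<gamma>) * s) * (tail k s - tail (Suc k) s)"
  using assms
proof (induction k arbitrary: s)
  case 0
  let ?B = "lam (real n + \<gamma>)"
  \<comment> \<open>Level 0 has no gain term, since \<open>tail 0\<close> is constantly 1. The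
    claimed lower bound 1 is the value of \<open>?f\<close> at 0.\<close>
  let ?f = "\<lambda>u. exp (?B * u) * (1 - tail (Suc 0) u)"
  have "?f 0 \<le> ?f s"
  proof (rule DERIV_nonneg_imp_increasing_open[OF 0(2)])
    fix u assume u: "0 < u" "u < s"
    have "DERIV ?f u :> exp (?B * u) * ((?B - level_rate 0 u) * (1 - tail (Suc 0) u))"
      by (rule derivative_eq_intros has_derivative_tail u refl | simp)+ (simp add: algebra_simps)
    moreover have "level_rate 0 u \<le> ?B"
      using level_rate_le[of u 0] lam_mono[of \<gamma> "real n + \<gamma>"] u gamma_pos by auto
    then have "0 \<le> exp (?B * u) * ((?B - level_rate 0 u) * (1 - tail (Suc 0) u))"
      using tail_nonneg_le_1 by (intro mult_nonneg_nonneg) auto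
    ultimately show "\<exists>y. DERIV ?f u :> y \<and> 0 \<le> y" by blast
  next
    show "continuous_on {0..s} ?f"
      by (intro continuous_intros continuous_on_subset[OF continuous_tail]) auto
  qed
  then show ?case by simp
next
  case (Suc k)
  let ?B = "lam (real n + \<gamma>)"
  let ?c = "\<lambda>i. lam ((real i + \<gamma>) / (t + 1))"
  let ?P = "\<lambda>k. \<Prod>i<k. ?c i"
  let ?q = "\<lambda>k u. tail k u - tail (Suc k) u"
  let ?f = "\<lambda>u. exp (?B * u) * ?q (Suc k) u - ?P (Suc k) * u ^ Suc k / fact (Suc k)"
  have "?f 0 \<le> ?f s"
  proof (rule DERIV_nonneg_imp_increasing_open[OF Suc.prems(2)])
    fix u assume u: "0 < u" "u < s"
    let ?D = "exp (?B * u) * ((?B - level_rate (Suc k) u) * ?q (Suc k) u + level_rate k u * ?q k u)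
       - ?P (Suc k) * u ^ k / fact k"
    have "DERIV ?f u :> exp (?B * u) * ((?B - level_rate (Suc k) u) * ?q (Suc k) u + level_rate k u * ?q k u)
       - ?P (Suc k) * (real (Suc k) * u ^ k) / fact (Suc k)"
      by (rule derivative_eq_intros has_derivative_tail u refl | simp del: prod.lessThan_Suc)+
        (simp add: algebra_simps del: prod.lessThan_Suc)
    moreover have "?P (Suc k) * (real (Suc k) * u ^ k) / fact (Suc k) = ?P (Suc k) * u ^ k / fact k"
      by (simp del: prod.lessThan_Suc of_nat_Suc)
    ultimately have "DERIV ?f u :> ?D" by (simp only:)
    moreover have "0 \<le> ?D"
    proof -
      have "level_rate (Suc k) u \<le> ?B"
        using level_rate_le[of u "Suc k"] lam_mono[of "real (Suc k) + \<gamma>" "real n + \<gamma>"] u gamma_pos Suc.prems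
        by auto
      then have "0 \<le> (?B - level_rate (Suc k) u) * ?q (Suc k) u"
        using tail_decreasing by (intro mult_nonneg_nonneg) auto
      then have 1: "exp (?B * u) * (level_rate k u * ?q k u)
          \<le> exp (?B * u) * ((?B - level_rate (Suc k) u) * ?q (Suc k) u + level_rate k u * ?q k u)"
        by (intro mult_left_mono) auto
      \<comment> \<open>The gain term is bounded below by the induction hypothesis and by the
        smallest rate of level k on [0,t]; the left side is the derivative of the polynomial in
        \<open>?f\<close>.\<close>
      have "?c k * (?P k * u ^ k / fact k) \<le> level_rate k u * (exp (?B * u) * ?q k u)"
      proof (intro mult_mono level_rate_ge)
        show "?P k * u ^ k / fact k \<le> exp (?B * u) * ?q k u"
          using u Suc.prems by (intro Suc.IH) auto
      qed (use u gamma_pos Suc.prems in \<open>auto intro!: level_rate_nonneg mult_nonneg_nonneg divide_nonneg_nonneg prod_nonneg lam_nonneg\<close>)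
      also have "\<dots> = exp (?B * u) * (level_rate k u * ?q k u)" by (rule mult.left_commute)
      also note 1
      finally show ?thesis by (simp add: mult_ac)
    qed
    ultimately show "\<exists>y. DERIV ?f u :> y \<and> 0 \<le> y" by blast
  next
    show "continuous_on {0..s} ?f"
      by (intro continuous_intros continuous_on_subset[OF continuous_tail]) auto
  qed
  then show ?case by simp
qed

text \<open>Under power bounds on the rates, the product over the first n levels contributes an n-th
  power times (n!)^\<beta>, and division by n! leaves (n!)^(\<beta> - 1). The lower bound comes from
  \<open>level_prob_ge\<close> with k = n, as being at level n implies having reached it.\<close>

lemma ln_tail_bounds:
  assumes t: "0 < t" and "0 < c"
    and upper: "\<And>k. lam (real k + \<gamma>) \<le> C * real (Suc k) powr \<beta>"
    and lower: "\<And>k. c * real (Suc k) powr \<beta> \<le> lam ((real k + \<gamma>) / (t + 1))"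
  shows "0 < tail n t"
    and "ln (tail n t) \<le> real n * ln (C * t) - (1 - \<beta>) * ln (fact n)"
    and "real n * ln (c * t) - (1 - \<beta>) * ln (fact n) - C * t * real (Suc n) powr \<beta> \<le> ln (tail n t)"
proof -
  have "0 < lam (real 0 + \<gamma>)" using gamma_pos by (intro lam_pos) auto
  then have C: "0 < C" using upper[of 0] by simp
  have fact_powr: "(\<Prod>k<n. d * real (Suc k) powr \<beta>) = d ^ n * fact n powr \<beta>" for d :: real
  proof -
    have "(\<Prod>k<n. real (Suc k)) = fact n"
      by (induction n) (auto simp: algebra_simps)
    then show ?thesis
      by (simp add: prod.distrib prod_powr_distrib[symmetric] del: of_nat_Suc)
  qed
  let ?L = "exp (- (C * t * real (Suc n) powr \<beta>)) * (c ^ n * fact n powr \<beta> * t ^ n / fact n)"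
  let ?U = "C ^ n * fact n powr \<beta> * t ^ n / fact n"
  have "c ^ n * fact n powr \<beta> * t ^ n / fact n \<le> (\<Prod>i<n. lam ((real i + \<gamma>) / (t + 1))) * t ^ n / fact n"
    unfolding fact_powr[symmetric]
    using t \<open>0 < c\<close> by (intro divide_right_mono mult_right_mono prod_mono lower conjI) auto
  also have "\<dots> \<le> exp (lam (real n + \<gamma>) * t) * (tail n t - tail (Suc n) t)"
    using t by (intro level_prob_ge) auto
  also have "\<dots> \<le> exp (C * t * real (Suc n) powr \<beta>) * tail n t"
  proof (intro mult_mono)
    have "lam (real n + \<gamma>) * t \<le> C * real (Suc n) powr \<beta> * t"
      using upper t by (intro mult_right_mono) auto
    then show "exp (lam (real n + \<gamma>) * t) \<le> exp (C * t * real (Suc n) powr \<beta>)"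
      by (simp add: mult_ac)
  qed (use tail_nonneg_le_1 tail_decreasing in auto)
  finally have L: "?L \<le> tail n t"
    by (simp add: exp_minus field_simps)
  have "tail n t \<le> (\<Prod>k<n. lam (real k + \<gamma>)) * t ^ n / fact n"
    using t by (intro tail_le) auto
  also have "\<dots> \<le> ?U"
    unfolding fact_powr[symmetric]
    using t gamma_pos
    by (intro divide_right_mono mult_right_mono prod_mono upper conjI lam_nonneg) auto
  finally have U: "tail n t \<le> ?U" .
  have "0 < ?L" using t \<open>0 < c\<close> by simp
  then show pos: "0 < tail n t" using L by linarith
  have ln_eq: "ln (d ^ n * fact n powr \<beta> * t ^ n / fact n) = real n * ln (d * t) - (1 - \<beta>) * ln (fact n)"
    if "0 < d" for d :: real
    using that t by (simp add: ln_div ln_mult ln_realpow ln_powr algebra_simps)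
  have "ln (tail n t) \<le> ln ?U" using U pos by simp
  then show "ln (tail n t) \<le> real n * ln (C * t) - (1 - \<beta>) * ln (fact n)"
    using ln_eq[OF C] by simp
  have "ln ?L \<le> ln (tail n t)" using L \<open>0 < ?L\<close> by simp
  moreover have "ln ?L = - (C * t * real (Suc n) powr \<beta>) + ln (c ^ n * fact n powr \<beta> * t ^ n / fact n)"
    using t \<open>0 < c\<close> by (subst ln_mult) auto
  ultimately show "real n * ln (c * t) - (1 - \<beta>) * ln (fact n) - C * t * real (Suc n) powr \<beta> \<le> ln (tail n t)"
    using ln_eq[OF \<open>0 < c\<close>] by simp
qed

end

section \<open>Factorial estimates and comparison of the rates with powers\<close>

text \<open>The induction step amounts to n ln(1 + 1/n) \<le> 1. The case n = 0 is separate because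
  of the division by n.\<close>

lemma ln_fact_ge: "real n * ln (real n) - real n \<le> ln (fact n)"
proof (induction n)
  case 0
  then show ?case by simp
next
  case (Suc n)
  show ?case
  proof (cases "n = 0")
    case False
    have "ln (1 + 1 / real n) \<le> 1 / real n"
      using False by (intro ln_add_one_self_le_self) auto
    moreover have "ln (1 + 1 / real n) = ln (real (Suc n)) - ln (real n)"
    proof -
      have "1 + 1 / real n = real (Suc n) / real n" using False by (simp add: field_simps)
      then show ?thesis using False by (simp add: ln_div del: of_nat_Suc)
    qed
    ultimately have "real n * (ln (real (Suc n)) - ln (real n)) \<le> real n * (1 / real n)"
      by (intro mult_left_mono) auto
    also have "\<dots> = 1" using False by simp
    finally have "real n * (ln (real (Suc n)) - ln (real n)) \<le> 1" .
    then have "real (Suc n) * ln (real (Suc n)) - real (Suc n) \<le>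
      ln (real (Suc n)) + (real n * ln (real n) - real n)"
      by (simp add: algebra_simps)
    also have "\<dots> \<le> ln (real (Suc n)) + ln (fact n)" using Suc.IH by simp
    also have "\<dots> = ln (fact (Suc n))" by (simp add: ln_mult del: of_nat_Suc)
    finally show ?thesis .
  qed simp
qed

lemma ln_fact_le: "ln (fact n) \<le> real n * ln (real n)"
proof (cases "n = 0")
  case False
  have "fact n \<le> real (n ^ n)" by (rule fact_le_power)
  then have "ln (fact n) \<le> ln (real n ^ n)" using False by simp
  then show ?thesis using False by (simp add: ln_realpow)
qed simp

text \<open>The sequence and its reciprocal both converge, hence both are bounded. The bounds hold
  at every index, which matters because the products of rates start at level 0.\<close>

lemma positive_seq_tendsto_positive_bounds:
  fixes a :: "nat \<Rightarrow> real"
  assumes "a \<longlonglongrightarrow> L" "0 < L" "\<And>k. 0 < a k"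
  obtains c C where "0 < c" "\<And>k. c \<le> a k" "\<And>k. a k \<le> C"
proof -
  obtain C where C: "\<And>k. norm (a k) \<le> C"
    using convergent_imp_Bseq[OF convergentI[OF assms(1)]] by (auto simp: Bseq_def)
  have "(\<lambda>k. inverse (a k)) \<longlonglongrightarrow> inverse L"
    using assms by (intro tendsto_inverse) auto
  then have "Bseq (\<lambda>k. inverse (a k))" by (intro convergent_imp_Bseq convergentI)
  then obtain K where K: "0 < K" "\<And>k. norm (inverse (a k)) \<le> K" unfolding Bseq_def by blast
  have "inverse K \<le> a k" for k
    using K(2)[of k] assms(3)[of k] K(1) by (auto simp: field_simps)
  then show thesis
    using C K(1) by (intro that[of "inverse K" C]) (auto simp: abs_le_iff)
qed

text \<open>With z = (k + \<gamma>)/d the quotient factors as lam(z)/z^\<beta> times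
  (z/(k+1))^\<beta>, and z/(k+1) tends to 1/d. The value d = 1 serves the largest rates and d = t +
  1 the smallest ones on [0,t].\<close>

lemma rate_along_levels:
  fixes lam :: "real \<Rightarrow> real"
  assumes "((\<lambda>z. lam z / z powr \<beta>) \<longlongrightarrow> \<alpha>) at_top" "0 < \<gamma>" "0 < d"
  shows "(\<lambda>k. lam ((real k + \<gamma>) / d) / real (Suc k) powr \<beta>) \<longlonglongrightarrow> \<alpha> * (1 / d) powr \<beta>"
proof -
  have lim: "filterlim (\<lambda>k. (real k + \<gamma>) / d) at_top sequentially"
    using assms(2,3) by real_asymp
  have "(\<lambda>k. ((real k + \<gamma>) / d) / real (Suc k)) \<longlonglongrightarrow> 1 / d"
  proof -
    have "(\<lambda>k. ((real k + \<gamma>) / d) / real (Suc k)) \<longlonglongrightarrow> inverse d"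
      using assms(2,3) by real_asymp
    then show ?thesis by (simp add: inverse_eq_divide)
  qed
  then have "(\<lambda>k. (((real k + \<gamma>) / d) / real (Suc k)) powr \<beta>) \<longlonglongrightarrow> (1 / d) powr \<beta>"
    using assms(3) by (intro tendsto_powr tendsto_const) auto
  from tendsto_mult[OF filterlim_compose[OF assms(1) lim] this]
  show ?thesis
  proof (rule Lim_transform_eventually[OF _ always_eventually], intro allI)
    fix k
    let ?z = "(real k + \<gamma>) / d"
    have "?z > 0" using assms(2,3) by (intro divide_pos_pos add_nonneg_pos) auto
    then show "lam ?z / ?z powr \<beta> * (?z / real (Suc k)) powr \<beta> = lam ?z / real (Suc k) powr \<beta>"
      by (subst powr_divide) auto
  qed
qed

section \<open>The logarithmic asymptotics of the tail\<close>

theorem theorem27: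
  fixes M :: "'a measure" and X :: "'a \<Rightarrow> real set"
    and lam :: "real \<Rightarrow> real" and \<gamma> \<alpha> \<beta> t :: real
  assumes "rate_function lam"
    and "\<gamma> > 0"
    and "self_exciting_process M X lam \<gamma>"
    and "\<alpha> > 0" and "0 < \<beta>" and "\<beta> < 1"
    and "((\<lambda>z. lam z / z powr \<beta>) \<longlongrightarrow> \<alpha>) at_top"
    and "t > 0"
  shows "((\<lambda>l :: real. 1 / (l * ln l) * ln (measure M {\<omega> \<in> space M. real (counting_process X t \<omega>) \<ge> l}))
           \<longlongrightarrow> - (1 - \<beta>)) at_top"
proof -
  interpret prob_space M
    using assms(3) by (simp add: self_exciting_process_def)
  interpret self_exciting M X lam \<gamma>
    using assms(1-3) by unfold_locales
  note \<beta> = assms(5,6) and t = assms(8)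
  obtain C where C: "\<And>k. lam ((real k + \<gamma>) / 1) / real (Suc k) powr \<beta> \<le> C"
  proof (rule positive_seq_tendsto_positive_bounds)
    show "(\<lambda>k. lam ((real k + \<gamma>) / 1) / real (Suc k) powr \<beta>) \<longlonglongrightarrow> \<alpha> * (1 / 1) powr \<beta>"
      by (rule rate_along_levels[OF assms(7) gamma_pos]) simp
    show "0 < lam ((real k + \<gamma>) / 1) / real (Suc k) powr \<beta>" for k
      using gamma_pos by (intro divide_pos_pos lam_pos) auto
  qed (use assms(4) in auto)
  obtain c where c: "0 < c" "\<And>k. c \<le> lam ((real k + \<gamma>) / (t + 1)) / real (Suc k) powr \<beta>"
  proof (rule positive_seq_tendsto_positive_bounds)
    show "(\<lambda>k. lam ((real k + \<gamma>) / (t + 1)) / real (Suc k) powr \<beta>) \<longlonglongrightarrow> \<alpha> * (1 / (t + 1)) powr \<beta>"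
      by (rule rate_along_levels[OF assms(7) gamma_pos]) (use t in simp)
    show "0 < lam ((real k + \<gamma>) / (t + 1)) / real (Suc k) powr \<beta>" for k
      using gamma_pos t by (intro divide_pos_pos lam_pos) auto
  qed (use assms(4) t in auto)
  have upper: "lam (real k + \<gamma>) \<le> C * real (Suc k) powr \<beta>" for k
    using C[of k] by (simp add: pos_divide_le_eq del: of_nat_Suc)
  have lower: "c * real (Suc k) powr \<beta> \<le> lam ((real k + \<gamma>) / (t + 1))" for k
    using c(2)[of k] by (simp add: pos_le_divide_eq del: of_nat_Suc)
  have "0 < lam (real 0 + \<gamma>)" using gamma_pos by (intro lam_pos) auto
  then have C_pos: "0 < C" using upper[of 0] by simp
  note bounds = ln_tail_bounds[OF t c(1) upper lower]
  \<comment> \<open>The logarithms may have either sign; absolute values allow n to be replaced by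
    its upper bound l + 1.\<close>
  define K\<^sub>1 K\<^sub>2 K\<^sub>3 where "K\<^sub>1 = \<bar>ln (C * t)\<bar>" and "K\<^sub>2 = \<bar>ln (c * t)\<bar>" and "K\<^sub>3 = C * t"
  let ?F = "\<lambda>l. ln (measure M {\<omega> \<in> space M. real (counting_process X t \<omega>) \<ge> l})"
  \<comment> \<open>\<open>?U\<close> and \<open>?L\<close> are the bounds of
    \<open>ln_tail_bounds\<close> at n = ceiling of l, written in l alone through l \<le> n \<le> l
    + 1 and the two factorial estimates. The shift l + 2 bounds \<open>Suc n\<close>.\<close>
  let ?U = "\<lambda>l. (l + 1) * K\<^sub>1 - (1 - \<beta>) * (l * ln l - (l + 1))"
  let ?L = "\<lambda>l. - (l + 1) * K\<^sub>2 - (1 - \<beta>) * ((l + 1) * ln (l + 1)) - K\<^sub>3 * (l + 2) powr \<beta>"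
  have sandwich: "?L l \<le> ?F l \<and> ?F l \<le> ?U l" if l: "2 \<le> l" for l
  proof -
    define n where "n = nat \<lceil>l\<rceil>"
    have n: "l \<le> real n" "real n \<le> l + 1" unfolding n_def using l by linarith+
    \<comment> \<open>The count is an integer, so rounding l up leaves the event unchanged.\<close>
    have "l \<le> real k \<longleftrightarrow> n \<le> k" for k unfolding n_def by (simp add: nat_ceiling_le_eq)
    then have F: "?F l = ln (tail n t)" by (simp add: tail_def)
    have n_times: "real n * x \<le> (l + 1) * \<bar>x\<bar>" for x
      by (rule order_trans[OF mult_left_mono[OF abs_ge_self] mult_right_mono]) (use n in auto)
    have "real n * ln (C * t) \<le> (l + 1) * K\<^sub>1"
      unfolding K\<^sub>1_def by (rule n_times)
    moreover have "l * ln l \<le> real n * ln (real n)"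
      using n l by (intro mult_mono) auto
    then have "(1 - \<beta>) * (l * ln l - (l + 1)) \<le> (1 - \<beta>) * ln (fact n)"
      using ln_fact_ge[of n] n \<beta> by (intro mult_left_mono) auto
    ultimately have "?F l \<le> ?U l" using bounds(2)[of n] F by linarith
    have "- (real n * ln (c * t)) \<le> (l + 1) * K\<^sub>2"
      using n_times[of "- ln (c * t)"] by (simp add: K\<^sub>2_def)
    moreover have "real n * ln (real n) \<le> (l + 1) * ln (l + 1)"
      using n l by (intro mult_mono) auto
    then have "(1 - \<beta>) * ln (fact n) \<le> (1 - \<beta>) * ((l + 1) * ln (l + 1))"
      using ln_fact_le[of n] \<beta> by (intro mult_left_mono) auto
    moreover have "C * t * real (Suc n) powr \<beta> \<le> K\<^sub>3 * (l + 2) powr \<beta>"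
      unfolding K\<^sub>3_def using n \<beta> C_pos t by (intro mult_left_mono powr_mono2) auto
    ultimately have "?L l \<le> ?F l" using bounds(3)[of n] F by (simp only: mult_minus_left)
    then show ?thesis using \<open>?F l \<le> ?U l\<close> by blast
  qed
  show ?thesis
  proof (rule tendsto_sandwich)
    show "\<forall>\<^sub>F l in at_top. 1 / (l * ln l) * ?L l \<le> 1 / (l * ln l) * ?F l"
      using eventually_ge_at_top[of 2]
      by eventually_elim (intro mult_left_mono, use sandwich in auto)
    show "\<forall>\<^sub>F l in at_top. 1 / (l * ln l) * ?F l \<le> 1 / (l * ln l) * ?U l"
      using eventually_ge_at_top[of 2]
      by eventually_elim (intro mult_left_mono, use sandwich in auto)
    show "((\<lambda>l. 1 / (l * ln l) * ?U l) \<longlongrightarrow> - (1 - \<beta>)) at_top"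
      using \<beta> by real_asymp
    \<comment> \<open>Since \<beta> < 1, the term (l + 2)^\<beta> is of smaller order than l ln l,
      as are the linear terms.\<close>
    show "((\<lambda>l. 1 / (l * ln l) * ?L l) \<longlongrightarrow> - (1 - \<beta>)) at_top"
      using \<beta> by real_asymp
  qed
qed

end
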